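(* Let $f\colon\mathbb{R}^n\to\mathbb{R}$ be convex and differentiable with $f_\star=\inf_{x\in\mathbb{R}^n}f(x)>-\infty$, let $T>0$ and $X_0\in\mathbb{R}^n$, and let $X\colon[0,T]\to\mathbb{R}^n$ be the extended solution to the OGM-G ODE $$0=\ddot X(t)-\frac{3}{t-T}\dot X(t)+2\nabla f(X(t)),\qquad t\in(0,T),\qquad X(0)=X_0,\ \dot X(0)=0.$$ Then $$\|\nabla f(X(T))\|^2\le\frac{4\left(f(X_0)-f(X(T))\right)}{T^2}\le\frac{4\left(f(X_0)-f_\star\right)}{T^2}.$$
   Context: $\mathbb{R}^n$ carries the Euclidean inner product $\langle\cdot,\cdot\rangle$ and norm $\|\cdot\|$. A dot denotes the derivative in $t$. A minimizer of $f$ is not assumed to exist. A solution of the OGM-G ODE is a function $X\colon[0,T)\to\mathbb{R}^n$ that satisfies the ODE on $(0,T)$, with $X$ and $\dot X$ continuous on $[0,T)$, and satisfies the initial conditions. "Extended solution" means the continuous extension of such a solution $X\colon[0,T)\to\mathbb{R}^n$ to the closed interval, with $X(T)=\lim_{t\to T^-}X(t)$; this limit exists for every solution. *)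

theory Defs
  imports "HOL-Analysis.Analysis"
begin

definition grad :: "('a::euclidean_space \<Rightarrow> real) \<Rightarrow> 'a \<Rightarrow> 'a" where
  "grad f x = (THE g. GDERIV f x :> g)"

lemma GDERIV_grad:
  fixes f :: "'a::euclidean_space \<Rightarrow> real"
  assumes "f differentiable (at x)"
  shows "GDERIV f x :> grad f x"
proof -
  obtain f' where f': "(f has_derivative f') (at x)"
    using assms by (auto simp: differentiable_def)
  then have lin: "linear f'"
    by (rule has_derivative_linear)
  define g where "g = adjoint f' 1"
  have "f' h = inner h g" for h
    using adjoint_works[OF lin, of h 1] by (simp add: g_def inner_commute)
  then have "GDERIV f x :> g"
    using has_derivative_eq_rhs[OF f', of "\<lambda>h. inner h g"] unfolding gderiv_def by (simp add: fun_eq_iff)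
  moreover have "g' = g" if "GDERIV f x :> g'" for g'
  proof -
    have "(\<lambda>h. inner h g') = (\<lambda>h. inner h g)"
      using that \<open>GDERIV f x :> g\<close> unfolding gderiv_def
      by (rule has_derivative_unique)
    then have "\<forall>h. inner h g' = inner h g"
      by (simp add: fun_eq_iff)
    then show ?thesis
      by (simp only: vector_eq_ldot)
  qed
  ultimately show ?thesis
    unfolding grad_def by (rule theI)
qed

(* A solution on [0,T): V is the first derivative of X (one-sided at 0) and A the second one.
   The coefficient of V is singular at t = T, and values of X outside [0,T) are irrelevant. *)
definition OGMG_solution ::
  "('a::euclidean_space \<Rightarrow> real) \<Rightarrow> real \<Rightarrow> 'a \<Rightarrow> (real \<Rightarrow> 'a) \<Rightarrow> bool" where
  "OGMG_solution f T X0 X \<longleftrightarrow>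
    (\<exists>V A.
      (\<forall>t\<in>{0..<T}. (X has_vector_derivative V t) (at t within {0..<T})) \<and>
      continuous_on {0..<T} X \<and> continuous_on {0..<T} V \<and>
      (\<forall>t\<in>{0<..<T}. (V has_vector_derivative A t) (at t)) \<and>
      (\<forall>t\<in>{0<..<T}.
        0 = A t - (3 / (t - T)) *\<^sub>R V t + 2 *\<^sub>R grad f (X t)) \<and>
      X 0 = X0 \<and> V 0 = 0)"

definition OGMG_extended_solution ::
  "('a::euclidean_space \<Rightarrow> real) \<Rightarrow> real \<Rightarrow> 'a \<Rightarrow> (real \<Rightarrow> 'a) \<Rightarrow> bool" where
  "OGMG_extended_solution f T X0 X \<longleftrightarrow>
    OGMG_solution f T X0 X \<and> (X \<longlongrightarrow> X T) (at_left T)"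

end

theory Submission
  imports Defs
begin

text \<open>
  Measure the motion relative to its endpoint p = X(T), in the dilated coordinate
  W(t) = (X(t) - p) / (T - t)^2. Multiplying the ODE for W by the derivative of W and
  integrating gives the energy

    E(t) = (T - t)^2 |W'(t)|^2 / 2 - 2 |W(t)|^2 + 2 (f(X(t)) - f(p)) / (T - t)^2,

  whose derivative is a positive multiple of f(X) + <grad f(X), p - X> - f(p). By convexity
  this is nonpositive, so E decreases (\<open>ogmg_energy_has_derivative\<close>, \<open>convex_grad_inequality\<close>).

  At t = 0 the velocity vanishes, the two terms in W cancel, and
  E(0) = 2 (f(X0) - f(p)) / T^2. At the other end the ODE is singular, and the damping
  fixes the asymptotics of the trajectory: with g = grad f(p) and s = T - t,
  X' = - s g + o(s), X - p = s^2 g / 2 + o(s^2) and f(X) - f(p) = s^2 |g|^2 / 2 + o(s^2),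
  so E tends to |g|^2 / 2 (\<open>ogmg_energy_tendsto\<close>). Monotonicity then gives
  |g|^2 / 2 \<le> 2 (f(X0) - f(p)) / T^2, which is the first inequality; the second one is
  f(p) \<ge> inf f.

  The asymptotics come from L'Hopital's rule and need grad f(X(t)) to tend to grad f(p),
  hence that a differentiable convex function is continuously differentiable
  (\<open>convex_isCont_grad\<close>).
\<close>

section \<open>Gradients of convex functions\<close>
lemma DERIV_grad_along_curve:
  fixes f :: "'a::euclidean_space \<Rightarrow> real"
  assumes X: "(X has_vector_derivative v) (at t)" and diff: "f differentiable (at (X t))"
  shows "DERIV (\<lambda>t. f (X t)) t :> inner (grad f (X t)) v"
proof -
  have "((\<lambda>t. f (X t)) has_derivative (\<lambda>h. inner (h *\<^sub>R v) (grad f (X t)))) (at t)"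
    by (rule has_derivative_compose[OF X[unfolded has_vector_derivative_def]
        GDERIV_grad[OF diff, unfolded gderiv_def]])
  then show ?thesis
    by (simp add: has_field_derivative_def inner_commute mult.commute[of "inner _ _"] mult_commute_abs)
qed

lemma directional_quotient_tendsto_grad:
  fixes f :: "'a::euclidean_space \<Rightarrow> real"
  assumes "f differentiable (at x)"
  shows "((\<lambda>h. (f (x + h *\<^sub>R e) - f x) / h) \<longlongrightarrow> inner (grad f x) e) (at_right 0)"
proof -
  have "((\<lambda>h. x + h *\<^sub>R e) has_vector_derivative e) (at 0)"
    by (auto intro!: derivative_eq_intros)
  from DERIV_grad_along_curve[OF this, of f] have "DERIV (\<lambda>h. f (x + h *\<^sub>R e)) 0 :> inner (grad f x) e"
    using assms by simp
  then show ?thesis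
    by (auto simp: DERIV_def intro: tendsto_within_subset)
qed

text \<open>
  By convexity the difference quotients of f at x in the direction y - x with step h < 1
  are at most the one with step 1; let h tend to 0.
\<close>
lemma convex_grad_inequality:
  fixes f :: "'a::euclidean_space \<Rightarrow> real"
  assumes convex: "convex_on UNIV f" and diff: "f differentiable (at x)"
  shows "f x + inner (grad f x) (y - x) \<le> f y"
proof -
  have "(f (x + h *\<^sub>R (y - x)) - f x) / h \<le> f y - f x" if "0 < h" "h < 1" for h
  proof -
    have "x + h *\<^sub>R (y - x) = (1 - h) *\<^sub>R x + h *\<^sub>R y"
      by (simp add: algebra_simps)
    then have "f (x + h *\<^sub>R (y - x)) \<le> (1 - h) * f x + h * f y"
      using convex_onD[OF convex, of h x y] that by simp
    then show ?thesis
      using that by (simp add: field_simps)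
  qed
  then have "\<forall>\<^sub>F h in at_right 0. (f (x + h *\<^sub>R (y - x)) - f x) / h \<le> f y - f x"
    by (auto simp: eventually_at_right_field intro!: exI[of _ 1])
  then have "inner (grad f x) (y - x) \<le> f y - f x"
    using directional_quotient_tendsto_grad[OF diff] by (intro tendsto_upperbound) auto
  then show ?thesis by simp
qed

text \<open>
  The slope <grad f(z), e> is at most every difference quotient (f(z + h e) - f(z)) / h,
  h > 0. Each of these quotients is continuous in z, and for small h it is below c at z = x.
\<close>
lemma convex_inner_grad_upper_semicontinuous:
  fixes f :: "'a::euclidean_space \<Rightarrow> real"
  assumes convex: "convex_on UNIV f" and diff: "\<And>x. f differentiable (at x)"
    and less: "inner (grad f x) e < c"
  shows "\<forall>\<^sub>F z in at x. inner (grad f z) e < c"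
proof -
  have "((\<lambda>h. (f (x + h *\<^sub>R e) - f x) / h) \<longlongrightarrow> inner (grad f x) e) (at_right 0)"
    by (rule directional_quotient_tendsto_grad[OF diff])
  then have "\<forall>\<^sub>F h in at_right 0. (f (x + h *\<^sub>R e) - f x) / h < c"
    using less by (rule order_tendstoD)
  moreover have "\<forall>\<^sub>F h in at_right (0::real). 0 < h"
    by (rule eventually_at_right_less)
  ultimately have "\<forall>\<^sub>F h in at_right 0. 0 < h \<and> (f (x + h *\<^sub>R e) - f x) / h < c"
    by eventually_elim simp
  then obtain h where h: "0 < h" "(f (x + h *\<^sub>R e) - f x) / h < c"
    using eventually_happens'[OF trivial_limit_at_right_real] by blast
  have cont: "isCont f z" for z
    using diff by (rule differentiable_imp_continuous_within)
  have "isCont (\<lambda>z. (f (z + h *\<^sub>R e) - f z) / h) x"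
    using h(1) by (intro continuous_intros isCont_o2[OF _ cont] cont) auto
  then have "\<forall>\<^sub>F z in at x. (f (z + h *\<^sub>R e) - f z) / h < c"
    using h(2) unfolding isCont_def by (rule order_tendstoD)
  then show ?thesis
  proof eventually_elim
    case (elim z)
    have "inner (grad f z) e \<le> (f (z + h *\<^sub>R e) - f z) / h"
      using convex_grad_inequality[OF convex diff, of z "z + h *\<^sub>R e"] h(1)
      by (simp add: field_simps)
    with elim show ?case by simp
  qed
qed

text \<open>Upper semicontinuity in the direction - e is lower semicontinuity in the direction e.\<close>
lemma convex_isCont_grad:
  fixes f :: "'a::euclidean_space \<Rightarrow> real"
  assumes "convex_on UNIV f" "\<And>x. f differentiable (at x)"
  shows "isCont (grad f) x"
proof -
  have "((\<lambda>z. inner (grad f z) e) \<longlongrightarrow> inner (grad f x) e) (at x)" for e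
  proof (rule order_tendstoI)
    fix c assume "c < inner (grad f x) e"
    then have "\<forall>\<^sub>F z in at x. inner (grad f z) (- e) < - c"
      by (intro convex_inner_grad_upper_semicontinuous assms) simp
    then show "\<forall>\<^sub>F z in at x. c < inner (grad f z) e"
      by eventually_elim simp
  qed (use convex_inner_grad_upper_semicontinuous[OF assms] in blast)
  then show ?thesis
    by (simp add: isCont_def tendsto_componentwise_iff[where f = "grad f"])
qed

section \<open>Asymptotics at the singular time\<close>
lemma DERIV_inverse_power_diff:
  fixes T t :: real
  assumes "t < T"
  shows "DERIV (\<lambda>t. inverse ((T - t) ^ n)) t :> real n / (T - t) ^ Suc n"
proof (cases n)
  case (Suc m)
  have "DERIV (\<lambda>t. (T - t) ^ n) t :> real n * (T - t) ^ m * (- 1)"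
    unfolding Suc by (rule derivative_eq_intros refl)+ simp
  then have "DERIV (\<lambda>t. inverse ((T - t) ^ n)) t :>
      - (inverse ((T - t) ^ n) * (real n * (T - t) ^ m * (- 1)) * inverse ((T - t) ^ n))"
    using assms by (intro DERIV_inverse') auto
  moreover have "- (inverse (s ^ n) * (real n * s ^ m * (- 1)) * inverse (s ^ n)) = real n / s ^ Suc n"
    if "s \<noteq> 0" for s :: real
    using that by (simp add: Suc field_simps)
  ultimately show ?thesis
    using assms by simp
qed simp

text \<open>
  1 / (T - t)^3 is an integrating factor of the damping: V / (T - t)^3 has derivative
  - 2 G / (T - t)^3. Since 1 / (T - t)^2 tends to infinity and has derivative
  2 / (T - t)^3, L'Hopital's rule at infinity gives the limit
  - g of the quotient V / (T - t). The rule is scalar, so it is used for each component.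
\<close>
lemma damped_velocity_asymptotics:
  fixes V A G :: "real \<Rightarrow> 'a::euclidean_space"
  assumes V: "\<forall>\<^sub>F t in at_left T. (V has_vector_derivative A t) (at t)"
    and ode: "\<forall>\<^sub>F t in at_left T. A t = (3 / (t - T)) *\<^sub>R V t - 2 *\<^sub>R G t"
    and G: "(G \<longlongrightarrow> g) (at_left T)"
  shows "((\<lambda>t. V t /\<^sub>R (T - t)) \<longlongrightarrow> - g) (at_left T)"
proof -
  have lt: "\<forall>\<^sub>F t in at_left T. t < T"
    by (simp add: eventually_at_filter)
  have comp: "((\<lambda>t. inner (V t) e / (T - t)) \<longlongrightarrow> - inner g e) (at_left T)" for e
  proof -
    have "((\<lambda>t. (inner (V t) e * inverse ((T - t) ^ 3)) / inverse ((T - t)\<^sup>2)) \<longlongrightarrow> - inner g e) (at_left T)"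
    proof (rule lhopital_left_at_top)
      have "filterlim (\<lambda>t. (T - t)\<^sup>2) (at_right 0) (at_left T)"
        unfolding filterlim_at
        using lt by (auto intro!: tendsto_eq_intros elim: eventually_mono)
      then show "LIM t at_left T. inverse ((T - t)\<^sup>2) :> at_top"
        by (rule filterlim_compose[OF filterlim_inverse_at_top_right])
      show "\<forall>\<^sub>F t in at_left T. 2 / (T - t) ^ 3 \<noteq> 0"
        using lt by eventually_elim simp
      show "\<forall>\<^sub>F t in at_left T.
          DERIV (\<lambda>t. inner (V t) e * inverse ((T - t) ^ 3)) t :> - 2 * inner (G t) e / (T - t) ^ 3"
        using V ode lt
      proof eventually_elim
        case (elim t)
        have "DERIV (\<lambda>t. inner (V t) e) t :> inner (A t) e"
          using bounded_linear.has_vector_derivative[OF bounded_linear_inner_left elim(1)]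
          by (simp add: has_real_derivative_iff_has_vector_derivative)
        from DERIV_mult[OF this DERIV_inverse_power_diff[OF elim(3), of 3]]
        have "DERIV (\<lambda>t. inner (V t) e * inverse ((T - t) ^ 3)) t :>
            inner (A t) e * inverse ((T - t) ^ 3) + 3 / (T - t) ^ 4 * inner (V t) e"
          by simp
        moreover have "3 / (t - T) = - (3 / (T - t))"
          using minus_divide_right[of 3 "T - t"] by simp
        then have "inner (A t) e = - (3 / (T - t)) * inner (V t) e - 2 * inner (G t) e"
          by (simp add: elim(2) inner_diff_left)
        moreover have "(- (3 / s) * v - 2 * w) * inverse (s ^ 3) + 3 / s ^ 4 * v = - 2 * w / s ^ 3"
          if "s \<noteq> 0" for s v w :: real
          using that by (simp add: field_simps power4_eq_xxxx power3_eq_cube)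
        ultimately show ?case
          using elim(3) by simp
      qed
      show "\<forall>\<^sub>F t in at_left T. DERIV (\<lambda>t. inverse ((T - t)\<^sup>2)) t :> 2 / (T - t) ^ 3"
        using lt
      proof eventually_elim
        case (elim t)
        then show ?case
          using DERIV_inverse_power_diff[of t T 2] by (simp add: numeral_3_eq_3)
      qed
      have "((\<lambda>t. - inner (G t) e) \<longlongrightarrow> - inner g e) (at_left T)"
        by (intro tendsto_intros G)
      moreover have "\<forall>\<^sub>F t in at_left T. - inner (G t) e
          = (- 2 * inner (G t) e / (T - t) ^ 3) / (2 / (T - t) ^ 3)"
        using lt by eventually_elim simp
      ultimately show "((\<lambda>t. (- 2 * inner (G t) e / (T - t) ^ 3) / (2 / (T - t) ^ 3))
          \<longlongrightarrow> - inner g e) (at_left T)"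
        by (rule Lim_transform_eventually)
    qed
    moreover have "\<forall>\<^sub>F t in at_left T. (inner (V t) e * inverse ((T - t) ^ 3)) / inverse ((T - t)\<^sup>2)
        = inner (V t) e / (T - t)"
    proof -
      have "(v * inverse (s ^ 3)) / inverse (s\<^sup>2) = v / s" if "s \<noteq> 0" for s v :: real
        using that by (simp add: field_simps power3_eq_cube power2_eq_square)
      then show ?thesis
        using lt by (auto elim!: eventually_mono)
    qed
    ultimately show ?thesis
      by (rule Lim_transform_eventually)
  qed
  have "inner (V t /\<^sub>R (T - t)) e = inner (V t) e / (T - t)" for t e
    by (simp add: divide_inverse_commute)
  then show ?thesis
    using comp by (simp add: tendsto_componentwise_iff[where f = "\<lambda>t. V t /\<^sub>R (T - t)"])
qed

text \<open>
  L'Hopital's rule for vectors, one component at a time; it is applied both to the position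
  and to the value of f along the trajectory.
\<close>
lemma tendsto_second_order_quotient:
  fixes u :: "real \<Rightarrow> 'a::euclidean_space"
  assumes u: "(u \<longlongrightarrow> u1) (at_left T)"
    and deriv: "\<forall>\<^sub>F t in at_left T. (u has_vector_derivative u' t) (at t)"
    and lim: "((\<lambda>t. u' t /\<^sub>R (T - t)) \<longlongrightarrow> c) (at_left T)"
  shows "((\<lambda>t. (u t - u1) /\<^sub>R (T - t)\<^sup>2) \<longlongrightarrow> - c /\<^sub>R 2) (at_left T)"
proof -
  have lt: "\<forall>\<^sub>F t in at_left T. t < T"
    by (simp add: eventually_at_filter)
  have comp: "((\<lambda>t. inner (u t - u1) e / (T - t)\<^sup>2) \<longlongrightarrow> - inner c e / 2) (at_left T)" for e
  proof (rule lhopital_left)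
    have "((\<lambda>t. u t - u1) \<longlongrightarrow> 0) (at_left T)"
      using u by (simp add: LIM_zero)
    then show "((\<lambda>t. inner (u t - u1) e) \<longlongrightarrow> 0) (at_left T)"
      using tendsto_inner[OF _ tendsto_const] by fastforce
    show "((\<lambda>t. (T - t)\<^sup>2) \<longlongrightarrow> 0) (at_left T)"
      by (auto intro!: tendsto_eq_intros)
    show "\<forall>\<^sub>F t in at_left T. (T - t)\<^sup>2 \<noteq> 0" "\<forall>\<^sub>F t in at_left T. - 2 * (T - t) \<noteq> 0"
      using lt by (auto elim: eventually_mono)
    show "\<forall>\<^sub>F t in at_left T. DERIV (\<lambda>t. inner (u t - u1) e) t :> inner (u' t) e"
      using deriv
    proof eventually_elim
      case (elim t)
      then have "((\<lambda>t. u t - u1) has_vector_derivative u' t) (at t)"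
        by (auto intro!: derivative_eq_intros)
      from bounded_linear.has_vector_derivative[OF bounded_linear_inner_left this]
      show ?case
        by (simp add: has_real_derivative_iff_has_vector_derivative)
    qed
    show "\<forall>\<^sub>F t in at_left T. DERIV (\<lambda>t. (T - t)\<^sup>2) t :> - 2 * (T - t)"
      by (auto intro!: always_eventually derivative_eq_intros)
    have "((\<lambda>t. - inner (u' t /\<^sub>R (T - t)) e / 2) \<longlongrightarrow> - inner c e / 2) (at_left T)"
      by (intro tendsto_intros lim) simp
    moreover have "- inner (u' t /\<^sub>R (T - t)) e / 2 = inner (u' t) e / (- 2 * (T - t))" for t
    proof -
      have "- (inverse s * w) / 2 = w / (- 2 * s)" for s w :: real
        by (cases "s = 0") (auto simp: field_simps)
      then show ?thesis
        unfolding inner_scaleR_left .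
    qed
    ultimately show "((\<lambda>t. inner (u' t) e / (- 2 * (T - t))) \<longlongrightarrow> - inner c e / 2) (at_left T)"
      by simp
  qed
  have quotient: "inner ((u t - u1) /\<^sub>R (T - t)\<^sup>2) e = inner (u t - u1) e / (T - t)\<^sup>2" for t e
    by (simp add: divide_inverse_commute)
  have "((\<lambda>t. inner ((u t - u1) /\<^sub>R (T - t)\<^sup>2) e) \<longlongrightarrow> inner (- c /\<^sub>R 2) e) (at_left T)" for e
    using comp[of e] unfolding quotient by simp
  then show ?thesis
    unfolding tendsto_componentwise_iff[where f = "\<lambda>t. (u t - u1) /\<^sub>R (T - t)\<^sup>2"] by blast
qed

section \<open>The energy\<close>

text \<open>
  With the dilated coordinate w = (x - p) / (T - t)^2 and its time derivative w', this is
  (T - t)^2 |w'|^2 / 2 - 2 |w|^2 + 2 (f x - f p) / (T - t)^2, expanded in x and v: the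
  terms in |x - p|^2 cancel.
\<close>
definition ogmg_energy :: "('a::real_inner \<Rightarrow> real) \<Rightarrow> real \<Rightarrow> 'a \<Rightarrow> real \<Rightarrow> 'a \<Rightarrow> 'a \<Rightarrow> real" where
  "ogmg_energy f T p t x v =
    inner v v / (2 * (T - t)\<^sup>2) + 2 * inner v (x - p) / (T - t) ^ 3
      + 2 * (f x - f p) / (T - t)\<^sup>2"

text \<open>
  Substituting the ODE for the acceleration, the terms in |V|^2, <V, X - p> and
  <grad f(X), V> all cancel. What remains is f(X) - f(p) minus its linearization at X,
  which for convex f is nonpositive.
\<close>
lemma ogmg_energy_has_derivative:
  fixes f :: "'a::euclidean_space \<Rightarrow> real" and X V :: "real \<Rightarrow> 'a"
  assumes diff: "f differentiable (at (X t))"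
    and X: "(X has_vector_derivative V t) (at t)"
    and V: "(V has_vector_derivative A) (at t)"
    and ode: "A = (3 / (t - T)) *\<^sub>R V t - 2 *\<^sub>R grad f (X t)"
    and t: "t < T"
  shows "DERIV (\<lambda>t. ogmg_energy f T p t (X t) (V t)) t :>
    4 / (T - t) ^ 3 * (f (X t) - f p - inner (grad f (X t)) (X t - p))"
proof -
  define s where "s = T - t"
  have s: "s > 0" using t by (simp add: s_def)
  have fX: "DERIV (\<lambda>t. f (X t) - f p) t :> inner (grad f (X t)) (V t)"
    using DERIV_grad_along_curve[OF X diff] by (auto intro!: derivative_eq_intros)
  have VV: "DERIV (\<lambda>t. inner (V t) (V t)) t :> 2 * inner A (V t)"
    using has_derivative_inner[OF V[unfolded has_vector_derivative_def] V[unfolded has_vector_derivative_def]]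
    by (simp add: has_field_derivative_def inner_commute[of _ A] algebra_simps mult_commute_abs)
  have VX: "DERIV (\<lambda>t. inner (V t) (X t - p)) t :> inner A (X t - p) + inner (V t) (V t)"
  proof -
    have "((\<lambda>t. X t - p) has_derivative (\<lambda>h. h *\<^sub>R V t)) (at t)"
      using X unfolding has_vector_derivative_def by (auto intro!: derivative_eq_intros)
    from has_derivative_inner[OF V[unfolded has_vector_derivative_def] this]
    show ?thesis
      unfolding has_field_derivative_def
      by (rule has_derivative_eq_rhs) (simp add: fun_eq_iff algebra_simps)
  qed
  have s2: "DERIV (\<lambda>t. inverse ((T - t)\<^sup>2)) t :> 2 / s ^ 3"
    and s3: "DERIV (\<lambda>t. inverse ((T - t) ^ 3)) t :> 3 / s ^ 4"
    using DERIV_inverse_power_diff[OF t, of 2] DERIV_inverse_power_diff[OF t, of 3]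
    by (simp_all add: s_def eval_nat_numeral)
  note deriv = DERIV_add[OF DERIV_add[OF DERIV_cmult[OF DERIV_mult[OF VV s2], of "1 / 2"]
      DERIV_cmult[OF DERIV_mult[OF VX s3], of 2]] DERIV_cmult[OF DERIV_mult[OF fX s2], of 2]]
  have "3 / (t - T) = - (3 / s)"
    using minus_divide_right[of 3 s] by (simp add: s_def)
  then have A: "inner A y = - (3 / s) * inner (V t) y - 2 * inner (grad f (X t)) y" for y
    by (simp add: ode inner_diff_left)
  \<comment> \<open>a, b, c, d and F stand for |V|^2, <V, X - p>, <grad f(X), V>, <grad f(X), X - p>
    and f(X) - f(p).\<close>
  have cancel: "1 / 2 * (2 * (- (3 / s) * a - 2 * c) * inverse (s\<^sup>2) + 2 / s ^ 3 * a)
      + 2 * ((- (3 / s) * b - 2 * d + a) * inverse (s ^ 3) + 3 / s ^ 4 * b)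
      + 2 * (c * inverse (s\<^sup>2) + 2 / s ^ 3 * F) = 4 / s ^ 3 * (F - d)" for a b c d F
    using s by (simp add: field_simps power4_eq_xxxx power3_eq_cube power2_eq_square)
  have energy: "ogmg_energy f T p t (X t) (V t) = 1 / 2 * (inner (V t) (V t) * inverse ((T - t)\<^sup>2))
      + 2 * (inner (V t) (X t - p) * inverse ((T - t) ^ 3))
      + 2 * ((f (X t) - f p) * inverse ((T - t)\<^sup>2))" for t
    unfolding ogmg_energy_def divide_inverse inverse_mult_distrib
    by (simp only: mult.assoc mult.commute mult.left_commute inverse_1)
  show ?thesis
    unfolding energy using deriv unfolding A s_def[symmetric] cancel .
qed

text \<open>
  The energy is a polynomial in the rescaled velocity, position and value
  V / (T - t), (X - p) / (T - t)^2 and (f(X) - f(p)) / (T - t)^2. The limits of these are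
  - g, g / 2 and |g|^2 / 2 for g = grad f(p); the energy therefore tends to
  |g|^2 / 2 - |g|^2 + |g|^2.
\<close>
lemma ogmg_energy_tendsto:
  fixes f :: "'a::euclidean_space \<Rightarrow> real" and X V A :: "real \<Rightarrow> 'a"
  assumes diff: "\<And>x. f differentiable (at x)"
    and grad: "isCont (grad f) p"
    and X: "\<forall>\<^sub>F t in at_left T. (X has_vector_derivative V t) (at t)"
    and V: "\<forall>\<^sub>F t in at_left T. (V has_vector_derivative A t) (at t)"
    and ode: "\<forall>\<^sub>F t in at_left T. A t = (3 / (t - T)) *\<^sub>R V t - 2 *\<^sub>R grad f (X t)"
    and lim: "(X \<longlongrightarrow> p) (at_left T)"
  shows "((\<lambda>t. ogmg_energy f T p t (X t) (V t)) \<longlongrightarrow> (norm (grad f p))\<^sup>2 / 2) (at_left T)"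
proof -
  define g where "g = grad f p"
  have G: "((\<lambda>t. grad f (X t)) \<longlongrightarrow> g) (at_left T)"
    unfolding g_def by (rule isCont_tendsto_compose[OF grad lim])
  have v: "((\<lambda>t. V t /\<^sub>R (T - t)) \<longlongrightarrow> - g) (at_left T)"
    by (rule damped_velocity_asymptotics[OF V ode G])
  have d: "((\<lambda>t. (X t - p) /\<^sub>R (T - t)\<^sup>2) \<longlongrightarrow> g /\<^sub>R 2) (at_left T)"
    using tendsto_second_order_quotient[OF lim X v] by simp
  have "((\<lambda>t. (f (X t) - f p) /\<^sub>R (T - t)\<^sup>2) \<longlongrightarrow> - (- inner g g) /\<^sub>R 2) (at_left T)"
  proof (rule tendsto_second_order_quotient)
    show "((\<lambda>t. f (X t)) \<longlongrightarrow> f p) (at_left T)"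
      by (rule isCont_tendsto_compose[OF differentiable_imp_continuous_within[OF diff] lim])
    show "\<forall>\<^sub>F t in at_left T. ((\<lambda>t. f (X t)) has_vector_derivative inner (grad f (X t)) (V t)) (at t)"
      using X by eventually_elim
        (simp add: DERIV_grad_along_curve diff flip: has_real_derivative_iff_has_vector_derivative)
    show "((\<lambda>t. inner (grad f (X t)) (V t) /\<^sub>R (T - t)) \<longlongrightarrow> - inner g g) (at_left T)"
      using tendsto_inner[OF G v] by simp
  qed
  then have F: "((\<lambda>t. (f (X t) - f p) /\<^sub>R (T - t)\<^sup>2) \<longlongrightarrow> inner g g / 2) (at_left T)"
    by simp
  have "((\<lambda>t. inner (V t /\<^sub>R (T - t)) (V t /\<^sub>R (T - t)) / 2
      + 2 * inner (V t /\<^sub>R (T - t)) ((X t - p) /\<^sub>R (T - t)\<^sup>2)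
      + 2 * ((f (X t) - f p) /\<^sub>R (T - t)\<^sup>2))
    \<longlongrightarrow> inner (- g) (- g) / 2 + 2 * inner (- g) (g /\<^sub>R 2) + 2 * (inner g g / 2)) (at_left T)"
    by (rule tendsto_add[OF tendsto_add[OF
          tendsto_divide[OF tendsto_inner[OF v v] tendsto_const]
          tendsto_mult_left[OF tendsto_inner[OF v d]]] tendsto_mult_left[OF F]]) simp
  moreover have "inner (- g) (- g) / 2 + 2 * inner (- g) (g /\<^sub>R 2) + 2 * (inner g g / 2)
      = (norm g)\<^sup>2 / 2"
    by (simp add: power2_norm_eq_inner)
  moreover have "inner (V t /\<^sub>R (T - t)) (V t /\<^sub>R (T - t)) / 2
      + 2 * inner (V t /\<^sub>R (T - t)) ((X t - p) /\<^sub>R (T - t)\<^sup>2)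
      + 2 * ((f (X t) - f p) /\<^sub>R (T - t)\<^sup>2) = ogmg_energy f T p t (X t) (V t)" for t
    unfolding ogmg_energy_def divide_inverse inverse_mult_distrib power2_eq_square power3_eq_cube
      inner_scaleR_left inner_scaleR_right real_scaleR_def
    by (simp only: mult.assoc mult.commute mult.left_commute inverse_1)
  ultimately show ?thesis
    by (simp add: g_def)
qed

section \<open>The gradient bound at the terminal time\<close>
theorem theorem4p2:
  fixes f :: "real ^ 'n \<Rightarrow> real"
    and T :: real
    and X0 :: "real ^ 'n"
    and X :: "real \<Rightarrow> real ^ 'n"
  assumes "convex_on UNIV f"
    and "\<And>x. f differentiable (at x)"
    and "bdd_below (range f)"
    and "T > 0"
    and "OGMG_extended_solution f T X0 X"
  shows "(norm (grad f (X T)))\<^sup>2 \<le> 4 * (f X0 - f (X T)) / T\<^sup>2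
       \<and> 4 * (f X0 - f (X T)) / T\<^sup>2 \<le> 4 * (f X0 - (INF x. f x)) / T\<^sup>2"
proof
  note convex = assms(1) and diff = assms(2) and T = assms(4)
  from assms(5) obtain V A where
    X_within: "\<And>t. t \<in> {0..<T} \<Longrightarrow> (X has_vector_derivative V t) (at t within {0..<T})"
    and cont: "continuous_on {0..<T} X" "continuous_on {0..<T} V"
    and V: "\<And>t. t \<in> {0<..<T} \<Longrightarrow> (V has_vector_derivative A t) (at t)"
    and ode0: "\<And>t. t \<in> {0<..<T} \<Longrightarrow> 0 = A t - (3 / (t - T)) *\<^sub>R V t + 2 *\<^sub>R grad f (X t)"
    and init: "X 0 = X0" "V 0 = 0"
    and lim: "(X \<longlongrightarrow> X T) (at_left T)"
    unfolding OGMG_extended_solution_def OGMG_solution_def by blast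
  have X: "(X has_vector_derivative V t) (at t)" if "t \<in> {0<..<T}" for t
  proof -
    have "(X has_vector_derivative V t) (at t within {0<..<T})"
      using X_within[of t] that by (auto intro: has_vector_derivative_within_subset)
    then show ?thesis
      using that by (simp add: at_within_open[of t "{0<..<T}"])
  qed
  have ode: "A t = (3 / (t - T)) *\<^sub>R V t - 2 *\<^sub>R grad f (X t)" if "t \<in> {0<..<T}" for t
  proof -
    have "A t = (A t - (3 / (t - T)) *\<^sub>R V t + 2 *\<^sub>R grad f (X t))
        + ((3 / (t - T)) *\<^sub>R V t - 2 *\<^sub>R grad f (X t))"
      by simp
    then show ?thesis
      unfolding ode0[OF that, symmetric] by simp
  qed
  have ev: "\<forall>\<^sub>F t in at_left T. t \<in> {0<..<T}"
    using T by (auto simp: eventually_at_left_field intro!: exI[of _ 0])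
  define E where "E t = ogmg_energy f T (X T) t (X t) (V t)" for t
  have "E b \<le> E 0" if b: "b \<in> {0<..<T}" for b
  proof (rule DERIV_nonpos_imp_decreasing_open[of 0 b E])
    show "0 \<le> b" using b by simp
    show "\<exists>y. DERIV E t :> y \<and> y \<le> 0" if "0 < t" "t < b" for t
    proof (intro exI conjI)
      have t: "t \<in> {0<..<T}" using that b by simp
      show "DERIV E t :> 4 / (T - t) ^ 3 * (f (X t) - f (X T) - inner (grad f (X t)) (X t - X T))"
        unfolding E_def using t
        by (intro ogmg_energy_has_derivative[OF diff X V ode]) auto
      show "4 / (T - t) ^ 3 * (f (X t) - f (X T) - inner (grad f (X t)) (X t - X T)) \<le> 0"
        using t convex_grad_inequality[OF convex diff, of "X t" "X T"]
        by (intro mult_nonneg_nonpos) (auto simp: inner_diff_right)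
    qed
    have sub: "{0..b} \<subseteq> {0..<T}"
      using b by auto
    have contX: "continuous_on {0..b} X" and contV: "continuous_on {0..b} V"
      by (rule continuous_on_subset[OF cont(1) sub], rule continuous_on_subset[OF cont(2) sub])
    have "continuous_on UNIV f"
      using differentiable_imp_continuous_within[OF diff] by (simp add: continuous_on_eq_continuous_within)
    then have contf: "continuous_on {0..b} (\<lambda>t. f (X t))"
      using continuous_on_compose2[OF _ contX] by blast
    show "continuous_on {0..b} E"
      unfolding E_def ogmg_energy_def
      by (intro continuous_on_add continuous_on_divide continuous_on_mult continuous_on_inner
          continuous_on_diff continuous_on_power continuous_on_const continuous_on_id contX contV contf)
        (use b in auto)
  qed
  then have "\<forall>\<^sub>F t in at_left T. E t \<le> E 0"
    by (intro eventually_mono[OF ev])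
  moreover have "(E \<longlongrightarrow> (norm (grad f (X T)))\<^sup>2 / 2) (at_left T)"
    unfolding E_def
    by (rule ogmg_energy_tendsto[OF diff convex_isCont_grad[OF convex diff]
          eventually_mono[OF ev X] eventually_mono[OF ev V] eventually_mono[OF ev ode] lim])
  ultimately have "(norm (grad f (X T)))\<^sup>2 / 2 \<le> E 0"
    by (intro tendsto_upperbound) auto
  also have "E 0 = 2 * (f X0 - f (X T)) / T\<^sup>2"
    by (simp add: E_def ogmg_energy_def init)
  finally show "(norm (grad f (X T)))\<^sup>2 \<le> 4 * (f X0 - f (X T)) / T\<^sup>2"
    by simp
  have "(INF x. f x) \<le> f (X T)"
    by (rule cINF_lower[OF assms(3)]) simp
  then show "4 * (f X0 - f (X T)) / T\<^sup>2 \<le> 4 * (f X0 - (INF x. f x)) / T\<^sup>2"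
    by (intro divide_right_mono) auto
qed

end
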